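(* Consider the control-affine system $dx=(f(x,t)+B(x,t)u)\,dt+d(x,t)\,dt+G(x,t)\,d\mathscr{W}(t)$ and the differential feedback control law $$u^*(x,x_d,u_d,t)=u_d-\int_{x_d}^{x}R(q,t)^{-1}B(q,t)^{\top}M(q,t)\,\delta q$$ described in the context. Suppose that $M(x,t)=W(x,t)^{-1}\succ0$ is designed by the following convex optimization problem (CV-STEM), whose objective is the steady-state value $\frac{C}{2\alpha_\ell}\frac{\overline m}{\underline m}$ of the mean-squared tracking error bound $\frac{C}{2\alpha_\ell}\frac{\overline m}{\underline m}+\frac{\mathbb{E}[V_{s\ell}(0)]e^{-2\alpha_\ell t}}{\underline m}$: $$J_{CV}^*=\min_{\nu>0,\ \chi\in\mathbb{R},\ \bar W\succ0}\ \frac{C}{2\alpha_\ell}\chi$$ subject to $$\begin{bmatrix}H(\nu,\bar W)+2\alpha\bar W&\bar W\\ \bar W&-\nu\alpha_s^{-1}I\end{bmatrix}\preceq0,\quad\forall x,t,$$ $$-\partial_{b_i}\bar W+2\,\mathrm{sym}\left(\frac{\partial b_i}{\partial x}\bar W\right)=0,\quad\forall i=1,\dots,m,\ \forall x,t,$$ $$I\preceq\bar W(x,t)\preceq\chi I,\quad\forall x,t,$$ where $\nu=\overline m$, $\chi=\overline m/\underline m$, $\bar W=\nu W$, $b_i$ is the $i$th column of $B$, and $$H(\nu,\bar W)=-\frac{\partial\bar W}{\partial t}-\partial_f\bar W+2\,\mathrm{sym}\left(\frac{\partial f}{\partial x}\bar W\right)-\nu BR^{-1}B^{\top}.$$ If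 $u^*$ is designed as $u^*(x,x_d,u_d,t)=u_d-\int_{x_d}^{x}R(q,t)^{-1}B(q,t)^{\top}M(q,t)\,\delta q$ for this $M$, then the contraction condition $$\dot M+2\,\mathrm{sym}\left(M\frac{\partial\,(f(x,t)+B(x,t)u^*(x,x_d,u_d,t))}{\partial x}\right)+\Xi(x,t)\preceq0,\quad\forall x,t,$$ holds with $\Xi(x,t)=2\alpha M(x,t)+\alpha_sI$, and $\underline mI\preceq M(x,t)\preceq\overline mI$ for all $x,t$.
   Context: Notation: $\mathrm{sym}(A)=(A+A^{\top})/2$; $\|\cdot\|$ is the Euclidean/induced 2-norm and $\|\cdot\|_F$ the Frobenius norm; $\delta x$ is an infinitesimal displacement at fixed time; for $p(x,t)\in\mathbb{R}^n$ and $F(x,t)\in\mathbb{R}^{n\times n}$, $\partial_pF=\sum_{k=1}^n(\partial F/\partial x_k)p_k$. System: $t\in\mathbb{R}_+$, $x(t)\in\mathbb{R}^n$, $u\in\mathbb{R}^m$; $f:\mathbb{R}^n\times\mathbb{R}_+\to\mathbb{R}^n$ and $B:\mathbb{R}^n\times\mathbb{R}_+\to\mathbb{R}^{n\times m}$ are known smooth functions; $\mathscr{W}$ is a $w$-dimensional Wiener process; $d$ and $G$ are unknown bounded functions with $\sup_{x,t}\|d(x,t)\|=\bar d$ and $\|G(x,t)\|_F\le\bar g$. Control: $R(x,t)\succ0$ is a given weight matrix, $q$ is a smooth path connecting $x_d$ to $x$, and $x_d$ is a target trajectory satisfying $\dot x_d=f(x_d,t)+B(x_d,t)u_d$ with $u_d=u^*(x_d,x_d,u_d,t)$.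 The control law is used in differential form: $\delta u^*=-R(x,t)^{-1}B(x,t)^{\top}M(x,t)\,\delta x$, i.e. $\partial u^*/\partial x=-R^{-1}B^{\top}M$ in the contraction condition. In the contraction condition, $\dot M=\partial M/\partial t+\sum_k(\partial M/\partial x_k)\,(f+Bu^* )_k$, and $\partial(f+Bu^* )/\partial x$ is the total derivative in $x$ (including the dependence of $u^*$ on $x$). Constants: $\alpha\in(0,\infty)$ is the contraction rate; $\alpha_s=L_m\bar g^2(\alpha_G+1/2)$ with an arbitrary $\alpha_G\in(0,\infty)$ and $L_m$ a Lipschitz constant of $\partial M/\partial x_i$ in $x$ (the constraint uses $\alpha_s^{-1}$, so $\alpha_s>0$). The coefficient in the objective is $C/(2\alpha_\ell)>0$, treated as given, with $C=\bar g^2(2\alpha_G^{-1}+1)+(L_u\epsilon_{\ell0}+\bar d)^2\alpha_d^{-1}$ and $\alpha_\ell=\alpha-(\alpha_d/2+L_u\epsilon_{\ell1}\sqrt{\overline m/\underline m})>0$, where $\alpha_d\in(0,\infty)$ is arbitrary, $L_u$ is a Lipschitz constant of $f+Bu$ in $u$, and $\epsilon_{\ell0},\epsilon_{\ell1}\ge0$ are learning error constants. $V_{s\ell}(t)=\int_{x_d}^{x}\delta q^{\top}M(q,t)\,\delta q$. *)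

theory Defs
  imports "HOL-Analysis.Analysis"
begin

section \<open>Smooth functions\<close>

text \<open>Derivatives are taken within the domain, so that one-sided derivatives are used at
  the boundary (\<open>t = 0\<close>, or the end points of a path). The domains used below are convex with
  nonempty interior, where the derivative within the domain is unique.\<close>

primrec Ck_on :: "nat \<Rightarrow> ('a::real_normed_vector \<Rightarrow> 'b::real_normed_vector) \<Rightarrow> 'a set \<Rightarrow> bool" where
  "Ck_on 0 f S \<longleftrightarrow> continuous_on S f"
| "Ck_on (Suc k) f S \<longleftrightarrow>
     f differentiable_on S \<and> (\<forall>v. Ck_on k (\<lambda>x. frechet_derivative f (at x within S) v) S)"

definition smooth_on :: "('a::real_normed_vector \<Rightarrow> 'b::real_normed_vector) \<Rightarrow> 'a set \<Rightarrow> bool" where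
  "smooth_on f S \<longleftrightarrow> (\<forall>k. Ck_on k f S)"

section \<open>Matrices\<close>

definition msym :: "real^'n^'n \<Rightarrow> real^'n^'n" where
  "msym A = (1/2) *\<^sub>R (A + transpose A)"

definition posdef :: "real^'n^'n \<Rightarrow> bool" where
  "posdef A \<longleftrightarrow> transpose A = A \<and> (\<forall>v. v \<noteq> 0 \<longrightarrow> 0 < v \<bullet> (A *v v))"

definition possemidef :: "real^'n^'n \<Rightarrow> bool" where
  "possemidef A \<longleftrightarrow> transpose A = A \<and> (\<forall>v. 0 \<le> v \<bullet> (A *v v))"

definition loewner_le :: "real^'n^'n \<Rightarrow> real^'n^'n \<Rightarrow> bool"  (infix \<open>\<preceq>\<close> 50) where
  "A \<preceq> B \<longleftrightarrow> possemidef (B - A)"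

text \<open>The block matrix with rows \<open>(A, B)\<close> and \<open>(C, D)\<close>.\<close>

definition block_mat ::
  "real^'c^'a \<Rightarrow> real^'d^'a \<Rightarrow> real^'c^'b \<Rightarrow> real^'d^'b \<Rightarrow> real^('c + 'd)^('a + 'b)" where
  "block_mat A B C D = (\<chi> i j. case i of
      Inl a \<Rightarrow> (case j of Inl c \<Rightarrow> A $ a $ c | Inr d \<Rightarrow> B $ a $ d)
    | Inr b \<Rightarrow> (case j of Inl c \<Rightarrow> C $ b $ c | Inr d \<Rightarrow> D $ b $ d))"

section \<open>Partial derivatives of state- and time-dependent matrices\<close>

definition partial_x :: "'n \<Rightarrow> (real^'n \<Rightarrow> real \<Rightarrow> real^'n^'n) \<Rightarrow> real^'n \<Rightarrow> real \<Rightarrow> real^'n^'n" where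
  "partial_x k F x t = frechet_derivative (\<lambda>y. F y t) (at x) (axis k 1)"

definition partial_t :: "(real^'n \<Rightarrow> real \<Rightarrow> real^'n^'n) \<Rightarrow> real^'n \<Rightarrow> real \<Rightarrow> real^'n^'n" where
  "partial_t F x t = vector_derivative (\<lambda>s. F x s) (at t within {0..})"

definition partial_dir ::
  "real^'n \<Rightarrow> (real^'n \<Rightarrow> real \<Rightarrow> real^'n^'n) \<Rightarrow> real^'n \<Rightarrow> real \<Rightarrow> real^'n^'n" where
  "partial_dir p F x t = (\<Sum>k\<in>UNIV. (p $ k) *\<^sub>R partial_x k F x t)"

section \<open>The CV-STEM optimization problem\<close>

definition cvstem_H ::
  "(real^'n \<Rightarrow> real \<Rightarrow> real^'n) \<Rightarrow> (real^'n \<Rightarrow> real \<Rightarrow> real^'m^'n) \<Rightarrow> (real^'n \<Rightarrow> real \<Rightarrow> real^'m^'m)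
   \<Rightarrow> real \<Rightarrow> (real^'n \<Rightarrow> real \<Rightarrow> real^'n^'n) \<Rightarrow> real^'n \<Rightarrow> real \<Rightarrow> real^'n^'n" where
  "cvstem_H f B R \<nu> Wb x t =
     - partial_t Wb x t - partial_dir (f x t) Wb x t
     + 2 *\<^sub>R msym (jacobian (\<lambda>y. f y t) (at x) ** Wb x t)
     - \<nu> *\<^sub>R (B x t ** matrix_inv (R x t) ** transpose (B x t))"

text \<open>The decision variable is the triple \<open>(\<nu>, chi, Wb)\<close>. The function \<open>Wb\<close> ranges over the
  differentiable functions on the state space and the time half-line, so that the derivatives
  in the constraints exist.\<close>

definition cvstem_feasible ::
  "(real^'n \<Rightarrow> real \<Rightarrow> real^'n) \<Rightarrow> (real^'n \<Rightarrow> real \<Rightarrow> real^'m^'n) \<Rightarrow> (real^'n \<Rightarrow> real \<Rightarrow> real^'m^'m)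
   \<Rightarrow> real \<Rightarrow> real \<Rightarrow> real \<times> real \<times> (real^'n \<Rightarrow> real \<Rightarrow> real^'n^'n) \<Rightarrow> bool" where
  "cvstem_feasible f B R \<alpha> \<alpha>s = (\<lambda>(\<nu>, chi, Wb).
     \<nu> > 0 \<and>
     (\<lambda>(x, t). Wb x t) differentiable_on (UNIV \<times> {0..}) \<and>
     (\<forall>x. \<forall>t\<ge>0. posdef (Wb x t)) \<and>
     (\<forall>x. \<forall>t\<ge>0. block_mat (cvstem_H f B R \<nu> Wb x t + (2 * \<alpha>) *\<^sub>R Wb x t) (Wb x t)
                           (Wb x t) (- ((\<nu> * inverse \<alpha>s) *\<^sub>R mat 1)) \<preceq> 0) \<and>
     (\<forall>i. \<forall>x. \<forall>t\<ge>0. - partial_dir (column i (B x t)) Wb x t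
          + 2 *\<^sub>R msym (jacobian (\<lambda>y. column i (B y t)) (at x) ** Wb x t) = 0) \<and>
     (\<forall>x. \<forall>t\<ge>0. mat 1 \<preceq> Wb x t \<and> Wb x t \<preceq> chi *\<^sub>R mat 1))"

definition cvstem_objective ::
  "real \<Rightarrow> real \<Rightarrow> real \<times> real \<times> (real^'n \<Rightarrow> real \<Rightarrow> real^'n^'n) \<Rightarrow> real" where
  "cvstem_objective C \<alpha>l = (\<lambda>(\<nu>, chi, Wb). C / (2 * \<alpha>l) * chi)"

section \<open>The differential feedback control law\<close>

definition feedback_gain ::
  "(real^'n \<Rightarrow> real \<Rightarrow> real^'m^'n) \<Rightarrow> (real^'n \<Rightarrow> real \<Rightarrow> real^'m^'m) \<Rightarrow> (real^'n \<Rightarrow> real \<Rightarrow> real^'n^'n)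
   \<Rightarrow> real^'n \<Rightarrow> real \<Rightarrow> real^'n^'m" where
  "feedback_gain B R M x t = matrix_inv (R x t) ** transpose (B x t) ** M x t"

text \<open>\<open>q a x t\<close> is the path, parametrized over \<open>[0, 1]\<close>, that connects \<open>a\<close> to \<open>x\<close> at the fixed
  time \<open>t\<close>; \<open>u_star B R M q x a v t\<close> is the control at state \<open>x\<close>, target state \<open>a\<close> and target
  control \<open>v\<close>.\<close>

definition smooth_connecting_paths ::
  "(real^'n \<Rightarrow> real^'n \<Rightarrow> real \<Rightarrow> real \<Rightarrow> real^'n) \<Rightarrow> bool" where
  "smooth_connecting_paths q \<longleftrightarrow>
     (\<forall>a x. \<forall>t\<ge>0. smooth_on (q a x t) {0..1} \<and> pathstart (q a x t) = a \<and> pathfinish (q a x t) = x)"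

definition u_star ::
  "(real^'n \<Rightarrow> real \<Rightarrow> real^'m^'n) \<Rightarrow> (real^'n \<Rightarrow> real \<Rightarrow> real^'m^'m) \<Rightarrow> (real^'n \<Rightarrow> real \<Rightarrow> real^'n^'n)
   \<Rightarrow> (real^'n \<Rightarrow> real^'n \<Rightarrow> real \<Rightarrow> real \<Rightarrow> real^'n)
   \<Rightarrow> real^'n \<Rightarrow> real^'n \<Rightarrow> real^'m \<Rightarrow> real \<Rightarrow> real^'m" where
  "u_star B R M q x a v t = v - integral {0..1}
     (\<lambda>\<mu>. feedback_gain B R M (q a x t \<mu>) t *v
           vector_derivative (q a x t) (at \<mu> within {0..1}))"

text \<open>The one-form \<open>- R\<^sup>-\<^sup>1 B\<^sup>T M \<delta>x\<close> need not be exact, so the integral above may depend on the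
  paths and need not have this form as its derivative in \<open>x\<close>. The law is therefore used in
  differential form: a control \<open>u\<close>, as a function of the state at the fixed time \<open>t\<close>, obeys the
  law at \<open>x\<close> if it has the value \<open>u0\<close> prescribed by the integral and its differential at \<open>x\<close> is
  \<open>\<delta>u = - R\<^sup>-\<^sup>1 B\<^sup>T M \<delta>x\<close>. Such \<open>u\<close> always exist, and the integral control is itself one of them
  whenever it is differentiable with the intended differential.\<close>

definition obeys_differential_law ::
  "(real^'n \<Rightarrow> real \<Rightarrow> real^'m^'n) \<Rightarrow> (real^'n \<Rightarrow> real \<Rightarrow> real^'m^'m) \<Rightarrow> (real^'n \<Rightarrow> real \<Rightarrow> real^'n^'n)
   \<Rightarrow> real^'m \<Rightarrow> real^'n \<Rightarrow> real \<Rightarrow> (real^'n \<Rightarrow> real^'m) \<Rightarrow> bool" where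
  "obeys_differential_law B R M u0 x t u \<longleftrightarrow>
     u x = u0 \<and> (u has_derivative (\<lambda>\<delta>x. - (feedback_gain B R M x t *v \<delta>x))) (at x)"

definition contraction_condition ::
  "(real^'n \<Rightarrow> real \<Rightarrow> real^'n) \<Rightarrow> (real^'n \<Rightarrow> real \<Rightarrow> real^'m^'n) \<Rightarrow> (real^'n \<Rightarrow> real \<Rightarrow> real^'n^'n)
   \<Rightarrow> (real^'n \<Rightarrow> real \<Rightarrow> real^'n^'n) \<Rightarrow> (real^'n \<Rightarrow> real^'m) \<Rightarrow> real^'n \<Rightarrow> real \<Rightarrow> bool" where
  "contraction_condition f B M \<Xi> u x t \<longleftrightarrow>
     partial_t M x t + partial_dir (f x t + B x t *v u x) M x t
     + 2 *\<^sub>R msym (M x t ** jacobian (\<lambda>y. f y t + B y t *v u y) (at x))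
     + \<Xi> x t \<preceq> 0"

end

theory Submission
  imports Defs
begin

text \<open>
  With \<open>X = \<nu> M\<^sup>-\<^sup>1\<close> the decision variable, differentiating the inverse gives
  \<open>\<partial>M = - \<nu>\<^sup>-\<^sup>1 M (\<partial>X) M\<close>, and \<open>X M = \<nu> I\<close> gives
  \<open>2 sym (M J) = \<nu>\<^sup>-\<^sup>1 M (2 sym (J X)) M\<close>. Under the congruence
  \<open>A \<mapsto> \<nu>\<^sup>-\<^sup>1 M A M\<close> the equality constraints cancel all terms linear in \<open>u\<close>, and the left-hand side of
  the contraction condition becomes
  \<open>\<nu>\<^sup>-\<^sup>1 M (H + 2 \<alpha> X) M + \<alpha>\<^sub>s I - M B R\<^sup>-\<^sup>1 B\<^sup>T M\<close>. The block inequality bounds the first two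
  terms, and the last one is negative semidefinite.
\<close>

section \<open>Calculus of the matrix product and of the matrix inverse\<close>

lemma matrix_add_rdistrib:
  fixes A B :: "real^'b^'a"
  shows "(A + B) ** C = A ** C + B ** C"
  by (vector matrix_matrix_mult_def sum.distrib[symmetric] field_simps)

text \<open>Interpreted locally, this supplies distributivity, scaling and limit rules for the
  product; in finite dimension bilinearity alone gives the bound.\<close>

lemma bounded_bilinear_matrix_matrix_mult:
  "bounded_bilinear ((**) :: real^'b^'a \<Rightarrow> real^'c^'b \<Rightarrow> real^'c^'a)"
  unfolding bilinear_conv_bounded_bilinear[symmetric] bilinear_def
  by (intro conjI allI linearI)
    (simp_all only: matrix_add_ldistrib matrix_add_rdistrib scalar_matrix_assoc matrix_scalar_ac)

lemma bounded_bilinear_matrix_vector_mult: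
  "bounded_bilinear ((*v) :: real^'b^'a \<Rightarrow> real^'b \<Rightarrow> real^'a)"
  unfolding bilinear_conv_bounded_bilinear[symmetric] bilinear_def
  by (intro conjI allI linearI)
    (simp_all only: matrix_vector_right_distrib matrix_vector_mult_add_rdistrib
      scaleR_matrix_vector_assoc matrix_vector_mult_scaleR)

lemma tendsto_det [tendsto_intros]:
  fixes A :: "'a \<Rightarrow> real^'n^'n"
  assumes "(A \<longlongrightarrow> L) F"
  shows "((\<lambda>x. det (A x)) \<longlongrightarrow> det L) F"
  unfolding det_def
  by (intro tendsto_sum tendsto_mult tendsto_const tendsto_prod tendsto_vec_nth assms)

lemma matrix_inv_inverse:
  fixes A :: "real^'n^'n"
  assumes "invertible A"
  shows "A ** matrix_inv A = mat 1" "matrix_inv A ** A = mat 1"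
  using someI_ex[OF assms[unfolded invertible_def]] by (simp_all add: matrix_inv_def)

text \<open>For square matrices a right inverse is two-sided, so a single product pins down the
  value chosen by \<open>matrix_inv\<close>.\<close>

lemma matrix_inv_unique:
  fixes A :: "real^'n^'n"
  assumes "A ** B = mat 1"
  shows "matrix_inv A = B"
proof -
  have "invertible A"
    using assms by (auto simp: invertible_right_inverse)
  then have "matrix_inv A ** (A ** B) = B"
    by (simp add: matrix_mul_assoc matrix_inv_inverse)
  with assms show ?thesis
    by simp
qed

text \<open>Column \<open>l\<close> of the inverse solves \<open>A z = axis l 1\<close>, so Cramer's
  rule applies. Entries that are quotients of determinants reduce continuity of inversion to
  continuity of \<open>det\<close>.\<close>

lemma matrix_inv_cramer:
  fixes A :: "real^'n^'n"
  assumes "det A \<noteq> 0"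
  shows "matrix_inv A = (\<chi> k l. det (\<chi> i j. if j = k then axis l 1 $ i else A $ i $ j) / det A)"
proof -
  have "A *v (matrix_inv A *v axis l 1) = axis l 1" for l
    using assms by (simp add: matrix_vector_mul_assoc invertible_det_nz matrix_inv_inverse)
  then have "column l (matrix_inv A)
      = (\<chi> k. det (\<chi> i j. if j = k then axis l 1 $ i else A $ i $ j) / det A)" for l
    unfolding cramer[OF assms] matrix_vector_mult_basis by blast
  then show ?thesis
    by (simp add: vec_eq_iff column_def)
qed

lemma tendsto_matrix_inv:
  fixes A :: "'a \<Rightarrow> real^'n^'n"
  assumes A: "(A \<longlongrightarrow> L) F" and L: "invertible L"
  shows "((\<lambda>x. matrix_inv (A x)) \<longlongrightarrow> matrix_inv L) F"
proof -
  have d: "det L \<noteq> 0" using L by (simp add: invertible_det_nz)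
  have lim: "((\<lambda>x. (\<chi> k l. det (\<chi> i j. if j = k then axis l 1 $ i else A x $ i $ j) / det (A x)) :: real^'n^'n)
       \<longlongrightarrow> (\<chi> k l. det (\<chi> i j. if j = k then axis l 1 $ i else L $ i $ j) / det L)) F"
  proof (intro tendsto_intros A d)
    fix k l i j
    show "((\<lambda>x. if j = k then axis l 1 $ i else A x $ i $ j) \<longlongrightarrow> (if j = k then axis l 1 $ i else L $ i $ j)) F"
      by (auto intro!: tendsto_intros A)
  qed
  \<comment> \<open>Cramer's formula is available only where the determinant is nonzero; the nonzero
    limit \<open>det L\<close> makes this eventually true.\<close>
  have "\<forall>\<^sub>F x in F. det (A x) \<noteq> 0"
    using tendsto_det[OF A] d by (rule tendsto_imp_eventually_ne)
  then have "\<forall>\<^sub>F x in F. (\<chi> k l. det (\<chi> i j. if j = k then axis l 1 $ i else A x $ i $ j) / det (A x)) = matrix_inv (A x)"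
    by eventually_elim (simp add: matrix_inv_cramer)
  from Lim_transform_eventually[OF lim this] show ?thesis
    by (simp add: matrix_inv_cramer[OF d])
qed

text \<open>With \<open>N y\<close> the inverse of \<open>A y\<close>, the identity
  \<open>N y ** (A y - A x) ** N x = N x - N y\<close> holds near \<open>x\<close>. Splitting
  \<open>A y - A x\<close> into its linear part and a remainder writes the normalized error of
  \<open>N\<close> as one term with the normalized remainder \<open>E\<close> and one with the
  factor \<open>N y - N x\<close>; both vanish by continuity of inversion.\<close>

lemma has_derivative_matrix_inv:
  fixes A :: "'a::real_normed_vector \<Rightarrow> real^'n^'n"
  assumes A: "(A has_derivative A') (at x within S)" and inv: "invertible (A x)"
  shows "((\<lambda>y. matrix_inv (A y)) has_derivative (\<lambda>h. - (matrix_inv (A x) ** A' h ** matrix_inv (A x)))) (at x within S)"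
proof -
  interpret m: bounded_bilinear "(**) :: real^'n^'n \<Rightarrow> real^'n^'n \<Rightarrow> real^'n^'n"
    by (rule bounded_bilinear_matrix_matrix_mult)
  interpret A': bounded_linear A' by (rule has_derivative_bounded_linear[OF A])
  define N where "N = (\<lambda>y. matrix_inv (A y))"
  define E where "E = (\<lambda>y. (1 / norm (y - x)) *\<^sub>R (A y - (A x + A' (y - x))))"
  define Q where "Q = (\<lambda>y. (1 / norm (y - x)) *\<^sub>R A' (y - x))"
  have Alim: "(A \<longlongrightarrow> A x) (at x within S)"
    using has_derivative_continuous[OF A] by (simp add: continuous_within)
  have Nlim: "(N \<longlongrightarrow> N x) (at x within S)"
    unfolding N_def by (rule tendsto_matrix_inv[OF Alim inv])
  have Elim: "(E \<longlongrightarrow> 0) (at x within S)"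
    using A unfolding E_def has_derivative_within by simp
  \<comment> \<open>The quotient \<open>Q\<close> depends on the direction of approach and need not
    converge. Boundedness suffices, since it is multiplied by \<open>N y - N x\<close>, which tends
    to zero.\<close>
  have "Bfun Q (at x within S)"
  proof -
    obtain K where K: "\<And>h. norm (A' h) \<le> norm h * K" using A'.bounded by blast
    \<comment> \<open>The sign of \<open>K\<close> is not known, hence the absolute value. At
      \<open>y = x\<close> the factor \<open>1 / norm (y - x)\<close> is \<open>1 / 0 = 0\<close>,
      so the bound holds there too.\<close>
    have "norm (Q y) \<le> \<bar>K\<bar>" for y
    proof (cases "y = x")
      case False
      have "norm (A' (y - x)) \<le> \<bar>K\<bar> * norm (y - x)"
        using K[of "y - x"] mult_right_mono[OF abs_ge_self norm_ge_zero, of K "y - x"]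
        by (simp only: mult.commute[of K] mult.commute[of "\<bar>K\<bar>"])
      with False show ?thesis
        by (simp add: Q_def divide_simps)
    qed (simp add: Q_def)
    then show ?thesis by (intro BfunI always_eventually allI)
  qed
  moreover have "Zfun (\<lambda>y. N y - N x) (at x within S)"
    using Nlim unfolding tendsto_Zfun_iff .
  ultimately have NQ: "((\<lambda>y. (N y - N x) ** Q y) \<longlongrightarrow> 0) (at x within S)"
    unfolding tendsto_Zfun_iff diff_0_right by (intro m.Zfun_prod_Bfun)
  have lim: "((\<lambda>y. - (N y ** E y ** N x) - (N y - N x) ** Q y ** N x) \<longlongrightarrow> - (N x ** 0 ** N x) - 0 ** N x) (at x within S)"
    by (rule tendsto_diff[OF tendsto_minus[OF m.tendsto[OF m.tendsto[OF Nlim Elim] tendsto_const]]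
          m.tendsto[OF NQ tendsto_const]])
  have ev: "\<forall>\<^sub>F y in at x within S. - (N y ** E y ** N x) - (N y - N x) ** Q y ** N x
      = (1 / norm (y - x)) *\<^sub>R (N y - (N x + - (N x ** A' (y - x) ** N x)))"
  proof -
    have "\<forall>\<^sub>F y in at x within S. det (A y) \<noteq> 0"
      using tendsto_det[OF Alim] inv by (intro tendsto_imp_eventually_ne) (auto simp: invertible_det_nz)
    then show ?thesis
    proof eventually_elim
      case (elim y)
      then have 1: "N y ** A y = mat 1"
        by (simp add: N_def matrix_inv_inverse invertible_det_nz)
      have 2: "A x ** N x = mat 1" using inv by (simp add: N_def matrix_inv_inverse)
      have 3: "N y ** (A y - A x) ** N x = N x - N y"
        by (simp add: m.diff_left m.diff_right 1 matrix_mul_assoc[symmetric, of "N y" "A x" "N x"] 2)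
      have "N y ** E y ** N x = (1 / norm (y - x)) *\<^sub>R (N x - N y - N y ** A' (y - x) ** N x)"
        unfolding E_def diff_diff_eq[symmetric]
        by (simp only: m.scaleR_left m.scaleR_right m.diff_right[where b' = "A' (y - x)"] m.diff_left[where a' = "N y ** A' (y - x)"] 3)
      moreover have "(N y - N x) ** Q y ** N x
          = (1 / norm (y - x)) *\<^sub>R (N y ** A' (y - x) ** N x - N x ** A' (y - x) ** N x)"
        by (simp add: Q_def m.scaleR_left m.scaleR_right m.diff_left)
      ultimately show ?case
        by (simp add: algebra_simps)
    qed
  qed
  have "((\<lambda>y. (1 / norm (y - x)) *\<^sub>R (N y - (N x + - (N x ** A' (y - x) ** N x)))) \<longlongrightarrow> 0) (at x within S)"
    using Lim_transform_eventually[OF lim ev] by (simp add: m.zero_left m.zero_right)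
  moreover have "bounded_linear (\<lambda>h. - (N x ** A' h ** N x))"
    by (intro bounded_linear_minus bounded_linear_compose[OF m.bounded_linear_left]
        bounded_linear_compose[OF m.bounded_linear_right] A'.bounded_linear_axioms)
  ultimately show ?thesis
    unfolding has_derivative_within N_def by simp
qed

section \<open>Block matrices, definiteness and the Loewner order\<close>

lemma sum_UNIV_Plus:
  fixes g :: "'a::finite + 'b::finite \<Rightarrow> 'c::comm_monoid_add"
  shows "sum g UNIV = (\<Sum>a\<in>UNIV. g (Inl a)) + (\<Sum>b\<in>UNIV. g (Inr b))"
  unfolding UNIV_Plus_UNIV[symmetric] by (subst sum.Plus) auto

lemma block_mat_quadratic_form:
  fixes v :: "real^'a" and w :: "real^'b"
  defines "z \<equiv> (\<chi> s. case s of Inl a \<Rightarrow> v $ a | Inr b \<Rightarrow> w $ b) :: real^('a + 'b)"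
  shows "z \<bullet> (block_mat A B C D *v z) = v \<bullet> (A *v v) + v \<bullet> (B *v w) + w \<bullet> (C *v v) + w \<bullet> (D *v w)"
  unfolding z_def
  by (simp add: inner_vec_def matrix_vector_mult_def block_mat_def sum_UNIV_Plus
      distrib_left sum.distrib)

text \<open>The order includes symmetry, which the upper left block inherits through the
  \<open>Inl\<close> indices; this later makes \<open>M ** A ** M\<close> symmetric. The inequality
  is the quadratic form at the vector that stacks \<open>v\<close> on \<open>w\<close>.\<close>

lemma block_mat_le_0:
  fixes A :: "real^'a^'a" and D :: "real^'b^'b"
  assumes "block_mat A B C D \<preceq> 0"
  shows "transpose A = A" "v \<bullet> (A *v v) + v \<bullet> (B *v w) + w \<bullet> (C *v v) + w \<bullet> (D *v w) \<le> 0"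
proof -
  have sym: "transpose (- block_mat A B C D) = - block_mat A B C D"
    and nonneg: "0 \<le> z \<bullet> (- block_mat A B C D *v z)" for z
    using assms by (auto simp: loewner_le_def possemidef_def)
  have "block_mat A B C D $ Inl j $ Inl i = block_mat A B C D $ Inl i $ Inl j" for i j
    using sym by (simp add: transpose_def vec_eq_iff)
  then show "transpose A = A"
    by (simp add: block_mat_def transpose_def vec_eq_iff)
  show "v \<bullet> (A *v v) + v \<bullet> (B *v w) + w \<bullet> (C *v v) + w \<bullet> (D *v w) \<le> 0"
    using nonneg[of "\<chi> s. case s of Inl a \<Rightarrow> v $ a | Inr b \<Rightarrow> w $ b"]
    by (simp add: block_mat_quadratic_form bounded_bilinear.minus_left[OF bounded_bilinear_matrix_vector_mult])
qed

lemma inner_matrix_vector_transpose: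
  fixes A :: "real^'n^'m"
  shows "v \<bullet> (A *v w) = (transpose A *v v) \<bullet> w"
  by (simp add: dot_lmul_matrix[symmetric])

lemma transpose_add: "transpose (A + B) = transpose A + transpose B"
  and transpose_diff: "transpose (C - D) = transpose C - transpose D"
  and transpose_uminus: "transpose (- E) = - transpose E"
  by (simp_all add: transpose_def vec_eq_iff)

lemma posdef_invertible:
  assumes "posdef A"
  shows "invertible A"
proof -
  have "v = 0" if "A *v v = 0" for v
    using assms that unfolding posdef_def by (metis inner_zero_right less_irrefl)
  then show ?thesis
    by (simp add: invertible_left_inverse matrix_left_invertible_ker)
qed

lemma transpose_matrix_inv:
  fixes A :: "real^'n^'n"
  assumes "invertible A"
  shows "transpose (matrix_inv A) = matrix_inv (transpose A)"
  by (rule matrix_inv_unique[symmetric])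
    (simp add: matrix_transpose_mul[symmetric] matrix_inv_inverse assms)

text \<open>Substituting \<open>v = A w\<close> turns the quadratic form of the inverse at
  \<open>v\<close> into that of \<open>A\<close> at \<open>w\<close>.\<close>

lemma possemidef_matrix_inv:
  assumes A: "posdef A"
  shows "possemidef (matrix_inv A)"
  unfolding possemidef_def
proof (intro conjI allI)
  note inv = posdef_invertible[OF A]
  show "transpose (matrix_inv A) = matrix_inv A"
    using A by (simp add: transpose_matrix_inv inv posdef_def)
  fix v
  have "v = A *v (matrix_inv A *v v)"
    by (simp add: matrix_vector_mul_assoc matrix_inv_inverse inv)
  then have "v \<bullet> (matrix_inv A *v v) = (matrix_inv A *v v) \<bullet> (A *v (matrix_inv A *v v))"
    by (metis inner_commute)
  also have "\<dots> \<ge> 0"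
    using A by (cases "matrix_inv A *v v = 0") (auto simp: posdef_def intro: less_imp_le)
  finally show "0 \<le> v \<bullet> (matrix_inv A *v v)" .
qed

lemma possemidef_congruence:
  fixes T :: "real^'n^'m"
  assumes "possemidef A"
  shows "possemidef (T ** A ** transpose T)"
  using assms unfolding possemidef_def
  by (auto simp: matrix_transpose_mul matrix_mul_assoc matrix_vector_mul_assoc[symmetric]
      inner_matrix_vector_transpose[of _ T])

text \<open>With \<open>y = matrix_inv X *v z\<close>, the form of the inverse at \<open>z\<close>
  equals \<open>y \<bullet> (X *v y)\<close>, and each bound follows by expanding one suitable
  square. No diagonalization is involved.\<close>

lemma matrix_inv_loewner_bounds:
  fixes X :: "real^'n^'n"
  assumes X: "posdef X" and lo: "mat 1 \<preceq> X" and up: "X \<preceq> c *\<^sub>R mat 1"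
  shows "1 \<le> c" "inverse c *\<^sub>R mat 1 \<preceq> matrix_inv X" "matrix_inv X \<preceq> mat 1"
proof -
  interpret mv: bounded_bilinear "(*v) :: real^'n^'n \<Rightarrow> real^'n \<Rightarrow> real^'n"
    by (rule bounded_bilinear_matrix_vector_mult)
  note inv = posdef_invertible[OF X]
  have Xsym: "transpose X = X" using X by (simp add: posdef_def)
  have lo': "y \<bullet> y \<le> y \<bullet> (X *v y)" and up': "y \<bullet> (X *v y) \<le> c * (y \<bullet> y)" for y
    using lo up by (auto simp: loewner_le_def possemidef_def mv.diff_left mv.scaleR_left inner_diff_right)
  \<comment> \<open>At a unit vector the two bounds on \<open>X\<close> compare to
    \<open>1 \<le> c\<close>; positivity of \<open>c\<close> is used below to cancel it against its
    inverse.\<close>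
  obtain e :: "real^'n" where e: "norm e = 1"
    using vector_choose_size[of 1] by auto
  show c: "1 \<le> c"
    using order_trans[OF lo' up', of e] e by (simp add: dot_square_norm)
  have "possemidef (matrix_inv X)" by (rule possemidef_matrix_inv[OF X])
  then have sym: "transpose (matrix_inv X) = matrix_inv X" by (simp add: possemidef_def)
  have main: "inverse c * (z \<bullet> z) \<le> z \<bullet> (matrix_inv X *v z)" "z \<bullet> (matrix_inv X *v z) \<le> z \<bullet> z" for z
  proof -
    define y where "y = matrix_inv X *v z"
    have z: "z = X *v y"
      by (simp add: y_def matrix_vector_mul_assoc matrix_inv_inverse inv)
    let ?q = "y \<bullet> (X *v y)"
    have comm: "z \<bullet> y = ?q" unfolding z by (simp add: inner_commute)
    have zXy: "y \<bullet> (X *v z) = z \<bullet> z"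
      by (simp add: inner_matrix_vector_transpose Xsym z)
    \<comment> \<open>Expanding gives \<open>2 * ?q \<le> z \<bullet> z + y \<bullet> y\<close>, and
      the lower bound on \<open>X\<close> replaces \<open>y \<bullet> y\<close> by
      \<open>?q\<close>.\<close>
    have "0 \<le> (z - y) \<bullet> (z - y)" by simp
    then have "2 * ?q \<le> z \<bullet> z + y \<bullet> y"
      using comm by (simp add: inner_diff_left inner_diff_right inner_commute)
    with lo'[of y] have "?q \<le> z \<bullet> z" by simp
    then show "z \<bullet> (matrix_inv X *v z) \<le> z \<bullet> z"
      using comm by (simp add: y_def)
    \<comment> \<open>After the upper bound on \<open>X\<close>, the form at \<open>y - s z\<close>
      is at most \<open>?q + (c s^2 - 2 s) |z|^2\<close>; the value \<open>s = 1 / c\<close>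
      minimizes the coefficient and makes it \<open>- 1 / c\<close>.\<close>
    let ?s = "inverse c"
    let ?w = "y - ?s *\<^sub>R z"
    have "0 \<le> ?w \<bullet> ?w" by simp
    also have "\<dots> \<le> ?w \<bullet> (X *v ?w)" by (rule lo')
    also have "\<dots> = ?q - 2 * ?s * (z \<bullet> z) + ?s * ?s * (z \<bullet> (X *v z))"
      using zXy by (simp add: mv.diff_right mv.scaleR_right inner_diff_left inner_diff_right
          flip: z) (simp add: algebra_simps)
    also have "\<dots> \<le> ?q - 2 * ?s * (z \<bullet> z) + ?s * ?s * (c * (z \<bullet> z))"
      using up' by (intro add_left_mono mult_left_mono) auto
    also have "\<dots> = ?q - ?s * (z \<bullet> z)"
      using c by (simp add: field_simps)
    finally show "?s * (z \<bullet> z) \<le> z \<bullet> (matrix_inv X *v z)"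
      using comm by (simp add: y_def)
  qed
  show "inverse c *\<^sub>R mat 1 \<preceq> matrix_inv X" "matrix_inv X \<preceq> mat 1"
    using main by (auto simp: loewner_le_def possemidef_def transpose_diff sym transpose_scalar mv.diff_left
        mv.scaleR_left inner_diff_right)
qed

section \<open>Derivatives of the metric and Jacobian of the closed loop\<close>

lemma partial_dir_eq_frechet_derivative:
  assumes "(\<lambda>y. F y t) differentiable (at x)"
  shows "partial_dir p F x t = frechet_derivative (\<lambda>y. F y t) (at x) p"
proof -
  interpret bounded_linear "frechet_derivative (\<lambda>y. F y t) (at x)"
    using assms by (simp add: frechet_derivative_works has_derivative_bounded_linear)
  have "p = (\<Sum>k\<in>UNIV. (p $ k) *\<^sub>R axis k 1)"
    using basis_expansion[of p] by (simp add: scalar_mult_eq_scaleR)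
  then have "frechet_derivative (\<lambda>y. F y t) (at x) p
      = frechet_derivative (\<lambda>y. F y t) (at x) (\<Sum>k\<in>UNIV. (p $ k) *\<^sub>R axis k 1)" by simp
  then show ?thesis
    by (simp add: partial_dir_def partial_x_def sum scaleR)
qed

lemma partial_dir_add: "partial_dir (p + r) F x t = partial_dir p F x t + partial_dir r F x t"
  by (simp add: partial_dir_def scaleR_add_left sum.distrib)

text \<open>Since \<open>A *v u\<close> is the combination of the columns of \<open>A\<close> with
  coefficients \<open>u $ i\<close>, the derivative along the control term splits into the column
  derivatives of the equality constraints.\<close>

lemma partial_dir_matrix_vector_mult:
  "partial_dir (A *v u) F x t = (\<Sum>i\<in>UNIV. (u $ i) *\<^sub>R partial_dir (column i A) F x t)"
  unfolding partial_dir_def scaleR_sum_right matrix_vector_mult_def column_def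
  by (subst sum.swap) (simp add: scaleR_sum_left mult.commute)

lemma jacobian_eqI:
  fixes g :: "real^'n \<Rightarrow> real^'m"
  assumes "(g has_derivative (\<lambda>h. J *v h)) (at x)"
  shows "jacobian g (at x) = J"
  using frechet_derivative_at[OF assms] matrix_of_matrix_vector_mul[of J]
  by (simp add: jacobian_def)

text \<open>The derivative of \<nu> X^-1 is - \<nu> X^-1 (dX) X^-1; replacing both inverses by M /
  \<nu> leaves the factor 1 / \<nu>.\<close>

lemma partial_dir_matrix_inv:
  fixes X :: "real^'n \<Rightarrow> real \<Rightarrow> real^'n^'n"
  assumes M: "\<And>y. M y t = \<nu> *\<^sub>R matrix_inv (X y t)" and "\<nu> \<noteq> 0"
    and X: "(\<lambda>y. X y t) differentiable (at x)" "invertible (X x t)"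
  shows "partial_dir p M x t = - ((1 / \<nu>) *\<^sub>R (M x t ** partial_dir p X x t ** M x t))"
proof -
  let ?D = "frechet_derivative (\<lambda>y. X y t) (at x)"
  have "((\<lambda>y. M y t) has_derivative
      (\<lambda>h. \<nu> *\<^sub>R - (matrix_inv (X x t) ** ?D h ** matrix_inv (X x t)))) (at x)"
    unfolding M using X
    by (intro has_derivative_scaleR_right has_derivative_matrix_inv)
      (simp_all add: frechet_derivative_works[symmetric])
  then show ?thesis
    using \<open>\<nu> \<noteq> 0\<close> X
    by (simp add: partial_dir_eq_frechet_derivative differentiableI frechet_derivative_at[symmetric] M
        scalar_matrix_assoc[symmetric] matrix_scalar_ac)
qed

text \<open>The same computation in time, with derivatives within the half-line because
  \<open>M\<close> is tied to the inverse of \<open>X\<close> only at nonnegative times.\<close>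

lemma partial_t_matrix_inv:
  fixes X :: "real^'n \<Rightarrow> real \<Rightarrow> real^'n^'n"
  assumes M: "\<And>s. 0 \<le> s \<Longrightarrow> M x s = \<nu> *\<^sub>R matrix_inv (X x s)" and "\<nu> \<noteq> 0" "0 \<le> t"
    and X: "(\<lambda>s. X x s) differentiable (at t within {0..})" "invertible (X x t)"
  shows "partial_t M x t = - ((1 / \<nu>) *\<^sub>R (M x t ** partial_t X x t ** M x t))"
proof -
  \<comment> \<open>A derivative within a set is unique only at a limit point; the half-line is
    connected and not a singleton, so each of its points is one.\<close>
  have ne: "at t within {0::real..} \<noteq> bot"
  proof -
    have "{0::real..} \<noteq> {s}" for s
      by (metis finite.emptyI finite.insertI infinite_Ici)
    then have "t islimpt {0..}"
      using \<open>0 \<le> t\<close> by (intro connected_imp_perfect) auto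
    then show ?thesis
      by (simp add: trivial_limit_within)
  qed
  have "((\<lambda>s. X x s) has_derivative (\<lambda>h. h *\<^sub>R partial_t X x t)) (at t within {0..})"
    using X(1) unfolding partial_t_def vector_derivative_works has_vector_derivative_def .
  then have "((\<lambda>s. \<nu> *\<^sub>R matrix_inv (X x s)) has_derivative
      (\<lambda>h. \<nu> *\<^sub>R - (matrix_inv (X x t) ** (h *\<^sub>R partial_t X x t) ** matrix_inv (X x t)))) (at t within {0..})"
    by (intro has_derivative_scaleR_right has_derivative_matrix_inv X)
  then have "((\<lambda>s. M x s) has_derivative
      (\<lambda>h. \<nu> *\<^sub>R - (matrix_inv (X x t) ** (h *\<^sub>R partial_t X x t) ** matrix_inv (X x t)))) (at t within {0..})"
    by (rule has_derivative_transform[rotated 2]) (use \<open>0 \<le> t\<close> in \<open>auto simp: M\<close>)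
  then have "((\<lambda>s. M x s) has_vector_derivative
      - ((1 / \<nu>) *\<^sub>R (M x t ** partial_t X x t ** M x t))) (at t within {0..})"
    unfolding has_vector_derivative_def using \<open>\<nu> \<noteq> 0\<close> \<open>0 \<le> t\<close>
    by (simp add: M scalar_matrix_assoc[symmetric] matrix_scalar_ac mult.commute)
  then show ?thesis
    unfolding partial_t_def by (rule vector_derivative_within[OF ne])
qed

text \<open>Compose with the affine embeddings of the two slices. The state slice lies wholly in the
  domain, so its derivative is unrestricted; the time slice stays confined to the half-line.\<close>

lemma differentiable_slices:
  fixes F :: "'a::real_normed_vector \<Rightarrow> real \<Rightarrow> 'b::real_normed_vector"
  assumes "(\<lambda>(x, t). F x t) differentiable_on (UNIV \<times> {0..})" "0 \<le> t"
  shows "(\<lambda>y. F y t) differentiable (at x)" "(\<lambda>s. F x s) differentiable (at t within {0..})"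
proof -
  obtain D where D: "((\<lambda>(x, t). F x t) has_derivative D) (at (x, t) within UNIV \<times> {0..})"
    using assms by (force simp: differentiable_on_def differentiable_def)
  have "((\<lambda>y. (y, t)) has_derivative (\<lambda>h. (h, 0))) (at x)"
    by (auto intro!: derivative_eq_intros)
  then have "((\<lambda>(x, t). F x t) \<circ> (\<lambda>y. (y, t)) has_derivative D \<circ> (\<lambda>h. (h, 0))) (at x)"
    by (rule diff_chain_within) (rule has_derivative_subset[OF D], use assms in auto)
  then show "(\<lambda>y. F y t) differentiable (at x)"
    by (auto simp: o_def differentiable_def)
  have "((\<lambda>s. (x, s)) has_derivative (\<lambda>h. (0, h))) (at t within {0..})"
    by (auto intro!: derivative_eq_intros)
  then have "((\<lambda>(x, t). F x t) \<circ> (\<lambda>s. (x, s)) has_derivative D \<circ> (\<lambda>h. (0, h))) (at t within {0..})"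
    by (rule diff_chain_within) (rule has_derivative_subset[OF D], auto)
  then show "(\<lambda>s. F x s) differentiable (at t within {0..})"
    by (auto simp: o_def differentiable_def)
qed

lemma smooth_on_imp_differentiable_on: "smooth_on f S \<Longrightarrow> f differentiable_on S"
  unfolding smooth_on_def by (drule spec[of _ "Suc 0"]) simp

text \<open>Writing the product as a combination of columns lets the product rule yield the column
  Jacobians of the equality constraints, plus the feedback term \<open>- B x ** K\<close>.\<close>

lemma has_derivative_matrix_vector_mult_columns:
  fixes B :: "real^'n \<Rightarrow> real^'m^'n" and u :: "real^'n \<Rightarrow> real^'m"
  assumes B: "B differentiable (at x)" and u: "(u has_derivative (\<lambda>h. - (K *v h))) (at x)"
  shows "((\<lambda>y. B y *v u y) has_derivative
    (\<lambda>h. ((\<Sum>i\<in>UNIV. (u x $ i) *\<^sub>R jacobian (\<lambda>y. column i (B y)) (at x)) - B x ** K) *v h)) (at x)"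
proof -
  interpret mv: bounded_bilinear "(*v) :: real^'n^'n \<Rightarrow> real^'n \<Rightarrow> real^'n"
    by (rule bounded_bilinear_matrix_vector_mult)
  interpret mv': bounded_bilinear "(*v) :: real^'m^'n \<Rightarrow> real^'m \<Rightarrow> real^'n"
    by (rule bounded_bilinear_matrix_vector_mult)
  let ?J = "\<lambda>i. jacobian (\<lambda>y. column i (B y)) (at x)"
  have blin: "bounded_linear (column i :: real^'m^'n \<Rightarrow> real^'n)" for i
    by (auto simp: linear_conv_bounded_linear[symmetric] column_def vec_eq_iff intro!: linearI)
  have col: "((\<lambda>y. column i (B y)) has_derivative (\<lambda>h. ?J i *v h)) (at x)" for i
  proof -
    obtain D where "(B has_derivative D) (at x)"
      using B by (auto simp: differentiable_def)
    then have "(\<lambda>y. column i (B y)) differentiable (at x)"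
      by (auto intro: differentiableI bounded_linear.has_derivative[OF blin])
    then show ?thesis
      by (simp only: jacobian_works[symmetric])
  qed
  have comp: "((\<lambda>y. u y $ i) has_derivative (\<lambda>h. (- (K *v h)) $ i)) (at x)" for i
    by (rule bounded_linear.has_derivative[OF bounded_linear_vec_nth u])
  have "((\<lambda>y. \<Sum>i\<in>UNIV. (u y $ i) *\<^sub>R column i (B y)) has_derivative
      (\<lambda>h. \<Sum>i\<in>UNIV. (u x $ i) *\<^sub>R (?J i *v h) + ((- (K *v h)) $ i) *\<^sub>R column i (B x))) (at x)"
    by (intro has_derivative_sum has_derivative_scaleR comp col)
  moreover have "A *v w = (\<Sum>i\<in>UNIV. (w $ i) *\<^sub>R column i A)" for A :: "real^'m^'n" and w
    by (simp add: matrix_mult_sum scalar_mult_eq_scaleR)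
  ultimately show ?thesis
    by (simp add: sum.distrib mv.diff_left mv.sum_left mv.scaleR_left sum_subtractf matrix_vector_mul_assoc[symmetric])
qed

lemma jacobian_closed_loop:
  fixes f :: "real^'n \<Rightarrow> real^'n" and B :: "real^'n \<Rightarrow> real^'m^'n" and u :: "real^'n \<Rightarrow> real^'m"
  assumes "f differentiable (at x)" "B differentiable (at x)" "(u has_derivative (\<lambda>h. - (K *v h))) (at x)"
  shows "jacobian (\<lambda>y. f y + B y *v u y) (at x) = jacobian f (at x)
    + (\<Sum>i\<in>UNIV. (u x $ i) *\<^sub>R jacobian (\<lambda>y. column i (B y)) (at x)) - B x ** K"
proof (rule jacobian_eqI)
  have "(f has_derivative (\<lambda>h. jacobian f (at x) *v h)) (at x)"
    using assms(1) by (simp only: jacobian_works)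
  from has_derivative_add[OF this has_derivative_matrix_vector_mult_columns[OF assms(2,3)]]
  show "((\<lambda>y. f y + B y *v u y) has_derivative (\<lambda>h. (jacobian f (at x)
    + (\<Sum>i\<in>UNIV. (u x $ i) *\<^sub>R jacobian (\<lambda>y. column i (B y)) (at x)) - B x ** K) *v h)) (at x)"
    by (simp only: matrix_vector_mult_add_rdistrib[symmetric] add_diff_eq)
qed

section \<open>The congruence that carries the constraints into the contraction condition\<close>

lemma linear_msym: "linear (msym :: real^'n^'n \<Rightarrow> real^'n^'n)"
  by (intro linearI) (simp_all add: msym_def transpose_add transpose_scalar algebra_simps)

text \<open>In each half of the symmetrization \<open>X\<close> meets one of the outer factors
  \<open>M\<close> and collapses to a scalar; symmetry of \<open>M\<close> and \<open>X\<close>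
  matches the transposed half.\<close>

lemma matrix_congruence_msym:
  fixes J M X :: "real^'n^'n"
  assumes "transpose M = M" "transpose X = X" "X ** M = \<nu> *\<^sub>R mat 1" "M ** X = \<nu> *\<^sub>R mat 1"
  shows "M ** msym (J ** X) ** M = \<nu> *\<^sub>R msym (M ** J)"
proof -
  interpret m: bounded_bilinear "(**) :: real^'n^'n \<Rightarrow> real^'n^'n \<Rightarrow> real^'n^'n"
    by (rule bounded_bilinear_matrix_matrix_mult)
  have "M ** (J ** X) ** M = \<nu> *\<^sub>R (M ** J)"
    using assms by (simp add: matrix_mul_assoc[symmetric] m.scaleR_right)
  moreover have "M ** (X ** transpose J) ** M = \<nu> *\<^sub>R (transpose J ** M)"
    using assms by (simp add: matrix_mul_assoc m.scaleR_left)
  ultimately show ?thesis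
    using assms by (simp add: msym_def matrix_transpose_mul m.scaleR_left m.scaleR_right
      m.add_left m.add_right scaleR_add_right)
qed

text \<open>The block inequality is tested at the vectors \<open>(M z, s z)\<close>.\<close>

lemma lmi_imp_congruence_le:
  fixes A X M :: "real^'n^'n"
  assumes lmi: "block_mat A X X (- ((\<nu> * inverse s) *\<^sub>R mat 1)) \<preceq> 0"
    and M: "transpose M = M" "M ** X = \<nu> *\<^sub>R mat 1" "X ** M = \<nu> *\<^sub>R mat 1"
    and pos: "0 < \<nu>" "s \<noteq> 0"
  shows "possemidef (- ((1 / \<nu>) *\<^sub>R (M ** A ** M) + s *\<^sub>R mat 1))"
proof -
  interpret mv: bounded_bilinear "(*v) :: real^'n^'n \<Rightarrow> real^'n \<Rightarrow> real^'n"
    by (rule bounded_bilinear_matrix_vector_mult)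
  have "transpose (- ((1 / \<nu>) *\<^sub>R (M ** A ** M) + s *\<^sub>R mat 1))
      = - ((1 / \<nu>) *\<^sub>R (M ** A ** M) + s *\<^sub>R mat 1)"
    using block_mat_le_0(1)[OF lmi] M(1)
    by (simp add: transpose_diff transpose_uminus transpose_scalar matrix_transpose_mul matrix_mul_assoc)
  moreover have "(1 / \<nu>) * (z \<bullet> (M ** A ** M *v z)) + s * (z \<bullet> z) \<le> 0" for z
  proof -
    have XM: "X *v (M *v z) = \<nu> *\<^sub>R z"
      by (simp add: matrix_vector_mul_assoc M mv.scaleR_left)
    have MX: "(M *v z) \<bullet> (X *v z) = \<nu> * (z \<bullet> z)"
    proof -
      have "(M *v z) \<bullet> (X *v z) = z \<bullet> (M *v (X *v z))"
        by (simp add: inner_matrix_vector_transpose M)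
      then show ?thesis
        by (simp add: matrix_vector_mul_assoc M mv.scaleR_left)
    qed
    \<comment> \<open>For a lower component \<open>c z\<close> the last three terms sum to \<nu> (2
      c - c^2 / s) |z|^2. Taking \<open>c = s\<close> gives \<nu> s |z|^2, which is what the Schur
      complement would contribute.\<close>
    have "(M *v z) \<bullet> (A *v (M *v z)) + s * (\<nu> * (z \<bullet> z)) + s * (\<nu> * (z \<bullet> z))
        - \<nu> * inverse s * (s * (s * (z \<bullet> z))) \<le> 0"
      using block_mat_le_0(2)[OF lmi, of "M *v z" "s *\<^sub>R z"]
      by (simp add: mv.minus_left mv.scaleR_left mv.scaleR_right XM MX mult_ac)
    then have "(M *v z) \<bullet> (A *v (M *v z)) + \<nu> * (s * (z \<bullet> z)) \<le> 0"
      using pos by (simp add: field_simps)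
    moreover have "(M *v z) \<bullet> (A *v (M *v z)) = z \<bullet> (M ** A ** M *v z)"
      by (simp add: matrix_vector_mul_assoc[symmetric] inner_matrix_vector_transpose[of z M] M)
    ultimately show ?thesis
      using pos by (simp add: field_simps)
  qed
  then have "0 \<le> z \<bullet> (- ((1 / \<nu>) *\<^sub>R (M ** A ** M) + s *\<^sub>R mat 1) *v z)" for z
    by (simp only: mv.minus_left mv.add_left mv.scaleR_left inner_minus_right inner_add_right
        inner_scaleR_right matrix_vector_mul_lid neg_0_le_iff_le)
  ultimately show ?thesis
    unfolding possemidef_def by blast
qed

lemma possemidef_add: "possemidef A \<Longrightarrow> possemidef B \<Longrightarrow> possemidef (A + B)"
  by (auto simp: possemidef_def transpose_add matrix_vector_mult_add_rdistrib inner_add_right)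

text \<open>An exact identity, which isolates the part controlled by the block inequality from a
  subtracted congruence of the inverse weight.\<close>

lemma contraction_expression_eq:
  fixes f :: "real^'n \<Rightarrow> real \<Rightarrow> real^'n" and B :: "real^'n \<Rightarrow> real \<Rightarrow> real^'m^'n"
    and M X :: "real^'n \<Rightarrow> real \<Rightarrow> real^'n^'n"
  assumes M: "\<And>y s. 0 \<le> s \<Longrightarrow> M y s = \<nu> *\<^sub>R matrix_inv (X y s)"
    and \<nu>: "0 < \<nu>" and t: "0 \<le> t"
    and X: "(\<lambda>(x, t). X x t) differentiable_on (UNIV \<times> {0..})" "posdef (X x t)"
    and f: "(\<lambda>y. f y t) differentiable (at x)" and B: "(\<lambda>y. B y t) differentiable (at x)"
    and u: "(u has_derivative (\<lambda>h. - (feedback_gain B R M x t *v h))) (at x)"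
    and killing: "\<And>i. - partial_dir (column i (B x t)) X x t
          + 2 *\<^sub>R msym (jacobian (\<lambda>y. column i (B y t)) (at x) ** X x t) = 0"
    and R: "posdef (R x t)"
  shows "partial_t M x t + partial_dir (f x t + B x t *v u x) M x t
     + 2 *\<^sub>R msym (M x t ** jacobian (\<lambda>y. f y t + B y t *v u y) (at x))
     + ((2 * \<alpha>) *\<^sub>R M x t + s *\<^sub>R mat 1)
   = ((1 / \<nu>) *\<^sub>R (M x t ** (cvstem_H f B R \<nu> X x t + (2 * \<alpha>) *\<^sub>R X x t) ** M x t) + s *\<^sub>R mat 1)
     - M x t ** B x t ** matrix_inv (R x t) ** transpose (M x t ** B x t)"
proof -
  interpret m: bounded_bilinear "(**) :: real^'n^'n \<Rightarrow> real^'n^'n \<Rightarrow> real^'n^'n"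
    by (rule bounded_bilinear_matrix_matrix_mult)
  interpret ms: linear "msym :: real^'n^'n \<Rightarrow> real^'n^'n" by (rule linear_msym)
  note inv = posdef_invertible[OF X(2)]
  define N Y where "N = M x t" and "Y = X x t"
  \<comment> \<open>Linearity of this congruence allows each summand of \<open>cvstem_H\<close> to
    be transported separately.\<close>
  define \<Phi> where "\<Phi> A = (1 / \<nu>) *\<^sub>R (N ** A ** N)" for A
  interpret \<Phi>: linear \<Phi>
    by (intro linearI) (simp_all add: \<Phi>_def m.add_left m.add_right m.scaleR_left m.scaleR_right scaleR_add_right)
  have Y: "transpose Y = Y" and NY: "N ** Y = \<nu> *\<^sub>R mat 1" and YN: "Y ** N = \<nu> *\<^sub>R mat 1"
    using X(2) M[OF t] inv by (simp_all add: posdef_def Y_def N_def m.scaleR_left m.scaleR_right matrix_inv_inverse)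
  have N: "transpose N = N"
    using possemidef_matrix_inv[OF X(2)] M[OF t] by (simp add: possemidef_def N_def transpose_scalar)
  define J where "J = jacobian (\<lambda>y. f y t) (at x)"
  define Jb where "Jb i = jacobian (\<lambda>y. column i (B y t)) (at x)" for i
  define Q where "Q = B x t ** matrix_inv (R x t) ** transpose (B x t)"
  have sym: "\<Phi> (msym (A ** Y)) = msym (N ** A)" for A
    using matrix_congruence_msym[OF N Y YN NY, of A] \<nu> by (simp add: \<Phi>_def)
  have dt: "partial_t M x t = - \<Phi> (partial_t X x t)"
    unfolding \<Phi>_def N_def
    by (rule partial_t_matrix_inv) (use \<nu> t inv differentiable_slices(2)[OF X(1) t] M in auto)
  have dir: "partial_dir p M x t = - \<Phi> (partial_dir p X x t)" for p
    unfolding \<Phi>_def N_def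
    by (rule partial_dir_matrix_inv) (use \<nu> t inv differentiable_slices(1)[OF X(1) t] M in auto)
  \<comment> \<open>The equality constraints are weighted by the components of the control and
    summed; their image under \<open>\<Phi>\<close> trades the column Jacobians for the derivative
    of the metric along \<open>B u\<close>.\<close>
  have "(\<Sum>i\<in>UNIV. (u x $ i) *\<^sub>R (- partial_dir (column i (B x t)) X x t + 2 *\<^sub>R msym (Jb i ** Y))) = 0"
    unfolding Y_def Jb_def killing by simp
  then have "\<Phi> (\<Sum>i\<in>UNIV. (u x $ i) *\<^sub>R (- partial_dir (column i (B x t)) X x t + 2 *\<^sub>R msym (Jb i ** Y))) = 0"
    by simp
  then have kill: "(\<Sum>i\<in>UNIV. (u x $ i) *\<^sub>R (2 *\<^sub>R msym (N ** Jb i)))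
      = (\<Sum>i\<in>UNIV. (u x $ i) *\<^sub>R \<Phi> (partial_dir (column i (B x t)) X x t))"
    by (simp add: \<Phi>.sum \<Phi>.scaleR \<Phi>.add \<Phi>.diff \<Phi>.neg sym scaleR_diff_right sum_subtractf)
  have "transpose (matrix_inv (R x t)) = matrix_inv (R x t)"
    using possemidef_matrix_inv[OF R] by (simp add: possemidef_def)
  then have Q: "transpose Q = Q"
    by (simp add: Q_def matrix_transpose_mul matrix_mul_assoc)
  have \<Phi>Y: "\<Phi> Y = N"
    using \<nu> by (simp add: \<Phi>_def NY m.scaleR_left)
  have \<Phi>Q: "\<nu> *\<^sub>R \<Phi> Q = N ** Q ** N"
    using \<nu> by (simp add: \<Phi>_def)
  have BK: "B x t ** feedback_gain B R M x t = Q ** N"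
    by (simp add: feedback_gain_def Q_def N_def matrix_mul_assoc)
  \<comment> \<open>The feedback enters the Jacobian term twice, as \<open>- 2 N Q N\<close>, while
    \<open>cvstem_H\<close> accounts for \<open>- N Q N\<close> only; the difference is the
    subtracted term of the conclusion.\<close>
  have msymQ: "2 *\<^sub>R msym (N ** (Q ** N)) = 2 *\<^sub>R (N ** Q ** N)"
    by (simp add: msym_def matrix_transpose_mul N Q matrix_mul_assoc scaleR_2[symmetric])
  have jac: "jacobian (\<lambda>y. f y t + B y t *v u y) (at x) = J + (\<Sum>i\<in>UNIV. (u x $ i) *\<^sub>R Jb i) - Q ** N"
    unfolding J_def Jb_def BK[symmetric] by (rule jacobian_closed_loop[OF f B u])
  have "2 *\<^sub>R msym (N ** jacobian (\<lambda>y. f y t + B y t *v u y) (at x))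
      = 2 *\<^sub>R msym (N ** J) + (\<Sum>i\<in>UNIV. (u x $ i) *\<^sub>R (2 *\<^sub>R msym (N ** Jb i))) - 2 *\<^sub>R (N ** Q ** N)"
    unfolding jac msymQ[symmetric]
    by (simp add: m.add_right m.diff_right m.sum_right m.scaleR_right ms.add ms.diff ms.sum ms.scaleR
        scaleR_add_right scaleR_diff_right scaleR_sum_right mult.commute)
  moreover have "\<Phi> (cvstem_H f B R \<nu> X x t + (2 * \<alpha>) *\<^sub>R Y)
      = - \<Phi> (partial_t X x t) - \<Phi> (partial_dir (f x t) X x t) + 2 *\<^sub>R msym (N ** J) - N ** Q ** N + (2 * \<alpha>) *\<^sub>R N"
    unfolding cvstem_H_def Y_def[symmetric] J_def[symmetric] Q_def[symmetric]
    by (simp only: \<Phi>.add \<Phi>.diff \<Phi>.neg \<Phi>.scaleR sym \<Phi>Y \<Phi>Q)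
  moreover have "N ** B x t ** matrix_inv (R x t) ** transpose (N ** B x t) = N ** Q ** N"
    by (simp add: Q_def matrix_transpose_mul N matrix_mul_assoc)
  ultimately show ?thesis
    unfolding dt dir partial_dir_add partial_dir_matrix_vector_mult N_def[symmetric] Y_def[symmetric]
    unfolding \<Phi>.add \<Phi>.sum \<Phi>.scaleR kill \<Phi>_def[symmetric]
    by (simp add: scaleR_2)
qed

theorem theorem3:
  fixes f :: "real^'n \<Rightarrow> real \<Rightarrow> real^'n"
    and B :: "real^'n \<Rightarrow> real \<Rightarrow> real^'m^'n"
    and d :: "real^'n \<Rightarrow> real \<Rightarrow> real^'n"
    and G :: "real^'n \<Rightarrow> real \<Rightarrow> real^'w^'n"
    and R :: "real^'n \<Rightarrow> real \<Rightarrow> real^'m^'m"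
    and M W Wb :: "real^'n \<Rightarrow> real \<Rightarrow> real^'n^'n"
    and q :: "real^'n \<Rightarrow> real^'n \<Rightarrow> real \<Rightarrow> real \<Rightarrow> real^'n"
    and x\<^sub>d :: "real \<Rightarrow> real^'n" and u\<^sub>d :: "real \<Rightarrow> real^'m"
    and dbar gbar \<alpha> \<alpha>\<^sub>s \<alpha>\<^sub>G \<alpha>\<^sub>d \<alpha>\<^sub>l C L\<^sub>m L\<^sub>u \<epsilon>0 \<epsilon>1 m_up m_lo \<nu> chi :: real
  assumes smooth_f: "smooth_on (\<lambda>(x, t). f x t) (UNIV \<times> {0..})"
    and smooth_B: "smooth_on (\<lambda>(x, t). B x t) (UNIV \<times> {0..})"
    and d_bdd: "bdd_above ((\<lambda>(x, t). norm (d x t)) ` (UNIV \<times> {0..}))"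
    and d_sup: "(SUP (x, t) \<in> UNIV \<times> {0..}. norm (d x t)) = dbar"
      (* the norm of a matrix type is the Frobenius norm *)
    and G_bound: "\<And>x t. 0 \<le> t \<Longrightarrow> norm (G x t) \<le> gbar"
    and R_posdef: "\<And>x t. 0 \<le> t \<Longrightarrow> posdef (R x t)"
    and pos: "\<alpha> > 0" "\<alpha>\<^sub>G > 0" "\<alpha>\<^sub>d > 0" "\<epsilon>0 \<ge> 0" "\<epsilon>1 \<ge> 0"
    and L\<^sub>u: "\<And>x t. 0 \<le> t \<Longrightarrow> L\<^sub>u-lipschitz_on UNIV (\<lambda>u. f x t + B x t *v u)"
      (* Lipschitz in the induced 2-norm *)
    and L\<^sub>m: "\<And>i x y t. 0 \<le> t \<Longrightarrow>
          onorm ((*v) (partial_x i M x t - partial_x i M y t)) \<le> L\<^sub>m * norm (x - y)"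
    and \<alpha>\<^sub>s: "\<alpha>\<^sub>s = L\<^sub>m * gbar\<^sup>2 * (\<alpha>\<^sub>G + 1/2)" "\<alpha>\<^sub>s > 0"
    and \<alpha>\<^sub>l: "\<alpha>\<^sub>l = \<alpha> - (\<alpha>\<^sub>d / 2 + L\<^sub>u * \<epsilon>1 * sqrt (m_up / m_lo))" "\<alpha>\<^sub>l > 0"
    and C: "C = gbar\<^sup>2 * (2 * inverse \<alpha>\<^sub>G + 1) + (L\<^sub>u * \<epsilon>0 + dbar)\<^sup>2 * inverse \<alpha>\<^sub>d"
    and coeff_pos: "C / (2 * \<alpha>\<^sub>l) > 0"
    and M_W: "\<And>x t. 0 \<le> t \<Longrightarrow> M x t = matrix_inv (W x t)"
    and M_posdef: "\<And>x t. 0 \<le> t \<Longrightarrow> posdef (M x t)"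
    and Wb_W: "\<And>x t. 0 \<le> t \<Longrightarrow> Wb x t = \<nu> *\<^sub>R W x t"
    and \<nu>: "\<nu> = m_up"
    and chi: "chi = m_up / m_lo"
    and cvstem: "is_arg_min (cvstem_objective C \<alpha>\<^sub>l) (cvstem_feasible f B R \<alpha> \<alpha>\<^sub>s) (\<nu>, chi, Wb)"
    and q: "smooth_connecting_paths q"
    and target: "\<And>t. 0 \<le> t \<Longrightarrow>
          (x\<^sub>d has_vector_derivative (f (x\<^sub>d t) t + B (x\<^sub>d t) t *v u\<^sub>d t)) (at t within {0..})"
    and target_control: "\<And>t. 0 \<le> t \<Longrightarrow> u\<^sub>d t = u_star B R M q (x\<^sub>d t) (x\<^sub>d t) (u\<^sub>d t) t"
  shows "(\<forall>x. \<forall>t\<ge>0. \<forall>u. obeys_differential_law B R M (u_star B R M q x (x\<^sub>d t) (u\<^sub>d t) t) x t u \<longrightarrow>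
            contraction_condition f B M (\<lambda>x t. (2 * \<alpha>) *\<^sub>R M x t + \<alpha>\<^sub>s *\<^sub>R mat 1) u x t)
       \<and> (\<forall>x. \<forall>t\<ge>0. m_lo *\<^sub>R mat 1 \<preceq> M x t \<and> M x t \<preceq> m_up *\<^sub>R mat 1)"
proof -
  have \<nu>_pos: "0 < \<nu>" and X: "(\<lambda>(x, t). Wb x t) differentiable_on (UNIV \<times> {0..})"
    and X_posdef: "\<And>x t. 0 \<le> t \<Longrightarrow> posdef (Wb x t)"
    and lmi: "\<And>x t. 0 \<le> t \<Longrightarrow> block_mat (cvstem_H f B R \<nu> Wb x t + (2 * \<alpha>) *\<^sub>R Wb x t) (Wb x t)
                           (Wb x t) (- ((\<nu> * inverse \<alpha>\<^sub>s) *\<^sub>R mat 1)) \<preceq> 0"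
    and killing: "\<And>i x t. 0 \<le> t \<Longrightarrow> - partial_dir (column i (B x t)) Wb x t
          + 2 *\<^sub>R msym (jacobian (\<lambda>y. column i (B y t)) (at x) ** Wb x t) = 0"
    and lo: "\<And>x t. 0 \<le> t \<Longrightarrow> mat 1 \<preceq> Wb x t"
    and up: "\<And>x t. 0 \<le> t \<Longrightarrow> Wb x t \<preceq> chi *\<^sub>R mat 1"
    using cvstem by (auto simp: is_arg_min_def cvstem_feasible_def)
  \<comment> \<open>Undoing the normalization \<open>Wb = \<nu> W\<close> expresses the metric
    through the decision variable.\<close>
  have M_inv: "M x t = \<nu> *\<^sub>R matrix_inv (Wb x t)" if "0 \<le> t" for x t
  proof -
    interpret m: bounded_bilinear "(**) :: real^'n^'n \<Rightarrow> real^'n^'n \<Rightarrow> real^'n^'n"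
      by (rule bounded_bilinear_matrix_matrix_mult)
    have "W x t ** (\<nu> *\<^sub>R matrix_inv (Wb x t)) = Wb x t ** matrix_inv (Wb x t)"
      using Wb_W[OF that] by (simp add: m.scaleR_left m.scaleR_right)
    also have "\<dots> = mat 1"
      by (rule matrix_inv_inverse(1)[OF posdef_invertible[OF X_posdef[OF that]]])
    finally show ?thesis
      unfolding M_W[OF that] by (rule matrix_inv_unique)
  qed
  have "contraction_condition f B M (\<lambda>x t. (2 * \<alpha>) *\<^sub>R M x t + \<alpha>\<^sub>s *\<^sub>R mat 1) u x t"
    if t: "0 \<le> t" and u: "(u has_derivative (\<lambda>h. - (feedback_gain B R M x t *v h))) (at x)" for x t u
  proof -
    have eq: "\<nu> *\<^sub>R mat 1 = M x t ** Wb x t" "\<nu> *\<^sub>R mat 1 = Wb x t ** M x t"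
      using matrix_inv_inverse[OF posdef_invertible[OF X_posdef[OF t]], of x] M_inv[OF t, of x]
      by (simp_all add: scalar_matrix_assoc[symmetric] matrix_scalar_ac)
    have "possemidef (- ((1 / \<nu>) *\<^sub>R (M x t ** (cvstem_H f B R \<nu> Wb x t + (2 * \<alpha>) *\<^sub>R Wb x t) ** M x t)
        + \<alpha>\<^sub>s *\<^sub>R mat 1))"
      by (rule lmi_imp_congruence_le[OF lmi[OF t]])
        (use M_posdef[OF t] eq \<nu>_pos \<alpha>\<^sub>s(2) in \<open>auto simp: posdef_def\<close>)
    \<comment> \<open>The added term is the congruence of the inverse of \<open>R\<close> by
      \<open>M ** B\<close>, hence positive semidefinite.\<close>
    then have "possemidef (- ((1 / \<nu>) *\<^sub>R (M x t ** (cvstem_H f B R \<nu> Wb x t + (2 * \<alpha>) *\<^sub>R Wb x t) ** M x t)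
        + \<alpha>\<^sub>s *\<^sub>R mat 1) + M x t ** B x t ** matrix_inv (R x t) ** transpose (M x t ** B x t))"
      by (intro possemidef_add possemidef_congruence possemidef_matrix_inv R_posdef t)
    moreover note contraction_expression_eq[where M = M and X = Wb and f = f and B = B and R = R
        and u = u and x = x and t = t and \<alpha> = \<alpha> and s = \<alpha>\<^sub>s, OF M_inv \<nu>_pos t X X_posdef[OF t]
        differentiable_slices(1)[OF smooth_on_imp_differentiable_on[OF smooth_f] t]
        differentiable_slices(1)[OF smooth_on_imp_differentiable_on[OF smooth_B] t] u killing[OF t]
        R_posdef[OF t]]
    ultimately show ?thesis
      unfolding contraction_condition_def loewner_le_def
      by (simp only: diff_0 minus_diff_eq uminus_add_conv_diff)
  qed
  moreover have "m_lo *\<^sub>R mat 1 \<preceq> M x t \<and> M x t \<preceq> m_up *\<^sub>R mat 1" if t: "0 \<le> t" for x t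
  proof -
    \<comment> \<open>Inversion reverses the bounds on \<open>Wb\<close>; scaling by
      \<open>\<nu>\<close> then bounds the metric between \<open>\<nu> / chi\<close>, which is
      \<open>m_lo\<close>, and \<open>\<nu>\<close>, which is \<open>m_up\<close>.\<close>
    note bounds = matrix_inv_loewner_bounds[OF X_posdef[OF t, of x] lo[OF t] up[OF t]]
    have scale: "\<nu> *\<^sub>R A \<preceq> \<nu> *\<^sub>R A'" if "A \<preceq> A'" for A A' :: "real^'n^'n"
      using that \<nu>_pos
      by (simp add: loewner_le_def possemidef_def scaleR_diff_right[symmetric] transpose_scalar
          scaleR_matrix_vector_assoc[symmetric])
    have "\<nu> * inverse chi = m_lo"
      using bounds(1) \<nu>_pos by (simp add: chi \<nu>)
    then show ?thesis
      using scale[OF bounds(2)] scale[OF bounds(3)] by (simp add: M_inv[OF t] \<nu>)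
  qed
  ultimately show ?thesis
    by (auto simp: obeys_differential_law_def)
qed

end
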